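(* Let $\mathcal{U}_0,\mathcal{U}_0'\subset\mathbb{R}^L$ and $\mathcal{U}_i\subset\mathbb{R}^L$ ($i\in I$, $I$ finite) be uncertainty sets and let $f,g,h_i:\mathbb{R}^L\times\mathbb{R}^n\to\mathbb{R}$ ($i\in I$) be functions satisfying the assumptions (a)–(g) listed in the context. Then the robust fractional program $$\text{(R-S1)}\qquad \min_{\alpha\ge 0,\ x\in\mathbb{R}^n}\ \alpha\quad\text{s.t.}\quad \frac{f(a_0,x)}{g(a_0',x)}-\alpha\le 0\ \ \forall a_0\in\mathcal{U}_0,\ \forall a_0'\in\mathcal{U}_0',\qquad h_i(a_i,x)\le 0\ \ \forall a_i\in\mathcal{U}_i,\ \forall i\in I,$$ in which the uncertainty in the numerator is independent of the uncertainty in the denominator, is equivalent to the problem $$\text{(R-Schaible-S1)}\qquad \min_{\alpha\ge 0,\ t>0,\ y\in\mathbb{R}^n}\ \alpha$$ subject to $$t f\!\left(a_0,\frac{y}{t}\right)-\alpha\le 0\ \ \forall a_0\in\mathcal{U}_0,\qquad t\,g\!\left(a_0',\frac{y}{t}\right)\ge 1\ \ \forall a_0'\in\mathcal{U}_0',\qquad t\,h_i\!\left(a_i,\frac{y}{t}\right)\le 0\ \ \forall a_i\in\mathcal{U}_i,\ \forall i\in I,$$ via the substitution $x=y/t$. That is, a pair $(\alpha,x)$ is feasible for (R-S1) if and only if there exist $t>0$ and $y\in\mathbb{R}^n$ with $x=y/t$ such that $(\alpha,t,y)$ is feasible for (R-Schaible-S1).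
   Context: The uncertainty sets are non-empty and each is of the form $\{a\in\mathbb{R}^L : \tau_j(a)\le 0\ \ \forall j\in J\}$, with $J$ a finite set and with functions $\tau_j:\mathbb{R}^L\to\mathbb{R}$ that may differ between the sets. A vector $x\in\mathbb{R}^n$ is called feasible if $h_i(a_i,x)\le 0$ for all $a_i\in\mathcal{U}_i$ and all $i\in I$. The standing assumptions are: (a) the functions $\tau_j$ defining the uncertainty sets are convex, and the uncertainty sets $\mathcal{U}_0,\mathcal{U}_0',\mathcal{U}_i$ are convex and compact; (b) $f$ and $h_i$ are convex in $x$ for every fixed value of the uncertain parameter in its uncertainty set ($\mathcal{U}_0$ for $f$, $\mathcal{U}_i$ for $h_i$); (c) $g$ is concave in $x$ for every fixed value of the uncertain parameter in $\mathcal{U}_0'$; (d) $f$ and $h_i$ are concave in the uncertain parameter (as functions on $\mathbb{R}^L$) for every feasible $x$; (e) $g$ is convex in the uncertain parameter (as a function on $\mathbb{R}^L$) for every feasible $x$; (f) $g(a_0',x)>0$ for every $a_0'\in\mathcal{U}_0'$ and every feasible $x$; (g) for every feasible $x$, $f(a_0,x)\ge 0$ for at least one $a_0\in\mathcal{U}_0$. *)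

theory Defs
  imports "HOL-Analysis.Analysis"
begin

definition sublevel_set :: "'j set \<Rightarrow> ('j \<Rightarrow> 'a \<Rightarrow> real) \<Rightarrow> 'a set" where
  "sublevel_set J \<tau> = {a. \<forall>j\<in>J. \<tau> j a \<le> 0}"

definition robust_feasible ::
  "'i set \<Rightarrow> ('i \<Rightarrow> 'a set) \<Rightarrow> ('i \<Rightarrow> 'a \<Rightarrow> 'x \<Rightarrow> real) \<Rightarrow> 'x \<Rightarrow> bool" where
  "robust_feasible I U h x \<longleftrightarrow> (\<forall>i\<in>I. \<forall>a\<in>U i. h i a x \<le> 0)"

text \<open>The feasible sets of the two programs (R-S1) and (R-Schaible-S1). In both, the objective to be
  minimized is the first component.\<close>

definition RS1 ::
  "'a set \<Rightarrow> 'a set \<Rightarrow> 'i set \<Rightarrow> ('i \<Rightarrow> 'a set) \<Rightarrow>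
   ('a \<Rightarrow> 'x \<Rightarrow> real) \<Rightarrow> ('a \<Rightarrow> 'x \<Rightarrow> real) \<Rightarrow> ('i \<Rightarrow> 'a \<Rightarrow> 'x \<Rightarrow> real) \<Rightarrow> (real \<times> 'x) set" where
  "RS1 U\<^sub>0 U\<^sub>0' I U f g h = {(\<alpha>, x).
     0 \<le> \<alpha> \<and>
     (\<forall>a\<in>U\<^sub>0. \<forall>a'\<in>U\<^sub>0'. f a x / g a' x - \<alpha> \<le> 0) \<and>
     (\<forall>i\<in>I. \<forall>a\<in>U i. h i a x \<le> 0)}"

definition RSchaibleS1 ::
  "'a set \<Rightarrow> 'a set \<Rightarrow> 'i set \<Rightarrow> ('i \<Rightarrow> 'a set) \<Rightarrow>
   ('a \<Rightarrow> 'x \<Rightarrow> real) \<Rightarrow> ('a \<Rightarrow> 'x \<Rightarrow> real) \<Rightarrow> ('i \<Rightarrow> 'a \<Rightarrow> 'x \<Rightarrow> real) \<Rightarrow>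
   (real \<times> real \<times> 'x::real_vector) set" where
  "RSchaibleS1 U\<^sub>0 U\<^sub>0' I U f g h = {(\<alpha>, t, y).
     0 \<le> \<alpha> \<and> 0 < t \<and>
     (\<forall>a\<in>U\<^sub>0. t * f a (y /\<^sub>R t) - \<alpha> \<le> 0) \<and>
     (\<forall>a'\<in>U\<^sub>0'. t * g a' (y /\<^sub>R t) \<ge> 1) \<and>
     (\<forall>i\<in>I. \<forall>a\<in>U i. t * h i a (y /\<^sub>R t) \<le> 0)}"

end

theory Submission
  imports Defs
begin

text \<open>
  Fix a feasible \<open>x\<close>. Because numerator and denominator are uncertain independently of each
  other, the worst case of the denominator is its minimum over \<open>U\<^sub>0'\<close>, whatever the
  numerator is, and the factor \<open>t\<close> of the Schaible transform plays the role of the reciprocal of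
  this minimum. The minimum \<open>m\<close> is attained, since a convex function on all of
  \<open>\<real>\<^sup>L\<close> is continuous and \<open>U\<^sub>0'\<close> is compact, and it is positive
  because \<open>g\<close> is positive on \<open>U\<^sub>0'\<close>. For \<open>t = 1 / m\<close> the
  constraint \<open>t g \<ge> 1\<close> holds and \<open>t f\<close> is one of the quotients bounded in the
  fractional program. Conversely \<open>t g \<ge> 1\<close> says that \<open>1 / g \<le> t\<close>; then
  \<open>f / g \<le> t f \<le> \<alpha>\<close> where \<open>f \<ge> 0\<close>, and \<open>f / g < 0 \<le>
  \<alpha>\<close> where \<open>f < 0\<close>. This is the lemma
  \<open>robust_quotient_bound_iff_scaled\<close>. In the constraints on \<open>h\<close> the positive factor
  \<open>t\<close> cancels.

  Both programs minimize the same variable \<open>\<alpha>\<close>, and the substitution leaves it alone, so the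
  correspondence of feasible points is also one of minimizers (\<open>is_arg_min_transfer\<close>).
\<close>

text \<open>The scaling factor is the reciprocal of the minimum; that the bound is tight at some point is what
  turns \<open>t f\<close> into an actual quotient.\<close>

lemma normalizing_factor_exists:
  fixes G :: "'a::topological_space \<Rightarrow> real"
  assumes "compact K" "K \<noteq> {}" "continuous_on K G" and pos: "\<And>a. a \<in> K \<Longrightarrow> G a > 0"
  obtains t b where "t > 0" "\<And>a. a \<in> K \<Longrightarrow> t * G a \<ge> 1" "b \<in> K" "t = 1 / G b"
proof -
  obtain b where b: "b \<in> K" "\<And>a. a \<in> K \<Longrightarrow> G b \<le> G a"
    using continuous_attains_inf[OF assms(1-3)] by blast
  show thesis
    by (rule that[of "1 / G b" b]) (use b pos in \<open>auto simp: field_simps\<close>)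
qed

text \<open>The bound \<open>\<alpha> \<ge> 0\<close> makes the sign of the numerator irrelevant: for a negative numerator the
  inequality \<open>F a / G a' \<le> t * F a\<close> may fail, but the quotient is then below \<open>\<alpha>\<close> anyway.\<close>

lemma robust_quotient_bound_iff_scaled:
  fixes G :: "'a::topological_space \<Rightarrow> real" and F :: "'b \<Rightarrow> real"
  assumes K: "compact K" "K \<noteq> {}" "continuous_on K G"
    and pos: "\<And>a. a \<in> K \<Longrightarrow> G a > 0" and "\<alpha> \<ge> 0"
  shows "(\<forall>a\<in>A. \<forall>a'\<in>K. F a / G a' - \<alpha> \<le> 0) \<longleftrightarrow>
         (\<exists>t>0. (\<forall>a\<in>A. t * F a - \<alpha> \<le> 0) \<and> (\<forall>a'\<in>K. t * G a' \<ge> 1))"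
proof
  assume L: "\<forall>a\<in>A. \<forall>a'\<in>K. F a / G a' - \<alpha> \<le> 0"
  obtain t b where "t > 0" "\<And>a. a \<in> K \<Longrightarrow> t * G a \<ge> 1" "b \<in> K" "t = 1 / G b"
    using normalizing_factor_exists[OF K pos] by blast
  with L show "\<exists>t>0. (\<forall>a\<in>A. t * F a - \<alpha> \<le> 0) \<and> (\<forall>a'\<in>K. t * G a' \<ge> 1)"
    by (intro exI[of _ t]) auto
next
  assume "\<exists>t>0. (\<forall>a\<in>A. t * F a - \<alpha> \<le> 0) \<and> (\<forall>a'\<in>K. t * G a' \<ge> 1)"
  then obtain t where tF: "\<And>a. a \<in> A \<Longrightarrow> t * F a \<le> \<alpha>" and tG: "\<And>a'. a' \<in> K \<Longrightarrow> 1 \<le> t * G a'"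
    by auto
  have "F a / G a' \<le> \<alpha>" if "a \<in> A" "a' \<in> K" for a a'
  proof (cases "F a \<ge> 0")
    case True
    have "1 / G a' \<le> t"
      using tG[OF \<open>a' \<in> K\<close>] pos[OF \<open>a' \<in> K\<close>] by (simp add: pos_divide_le_eq)
    from mult_right_mono[OF this True] show ?thesis
      using tF[OF \<open>a \<in> A\<close>] by simp
  next
    case False
    then have "F a / G a' \<le> 0"
      using pos[OF \<open>a' \<in> K\<close>] by (simp add: divide_nonpos_pos)
    then show ?thesis
      using \<open>\<alpha> \<ge> 0\<close> by linarith
  qed
  then show "\<forall>a\<in>A. \<forall>a'\<in>K. F a / G a' - \<alpha> \<le> 0"
    by simp
qed

text \<open>A relation between the feasible points of two programs that preserves the objective value and is
  total on both sides makes the attained values equal, so related points are optimal together.\<close>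

lemma is_arg_min_transfer:
  fixes F :: "'a \<Rightarrow> 'c::order" and G :: "'b \<Rightarrow> 'c"
  assumes "P x" "Q y" "F x = G y"
    and "\<And>x. P x \<Longrightarrow> \<exists>y. Q y \<and> G y = F x"
    and "\<And>y. Q y \<Longrightarrow> \<exists>x. P x \<and> F x = G y"
  shows "is_arg_min F P x \<longleftrightarrow> is_arg_min G Q y"
  using assms unfolding is_arg_min_def by metis

theorem mainTheorem2:
  fixes U\<^sub>0 U\<^sub>0' :: "(real ^ 'l) set"
    and I :: "'i set"
    and U :: "'i \<Rightarrow> (real ^ 'l) set"
    and J\<^sub>0 :: "'j0 set" and \<tau>\<^sub>0 :: "'j0 \<Rightarrow> real ^ 'l \<Rightarrow> real"
    and J\<^sub>0' :: "'j1 set" and \<tau>\<^sub>0' :: "'j1 \<Rightarrow> real ^ 'l \<Rightarrow> real"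
    and J :: "'i \<Rightarrow> 'j set" and \<tau> :: "'i \<Rightarrow> 'j \<Rightarrow> real ^ 'l \<Rightarrow> real"
    and f g :: "real ^ 'l \<Rightarrow> real ^ 'n \<Rightarrow> real"
    and h :: "'i \<Rightarrow> real ^ 'l \<Rightarrow> real ^ 'n \<Rightarrow> real"
  assumes "finite I"
    and "finite J\<^sub>0" "U\<^sub>0 = sublevel_set J\<^sub>0 \<tau>\<^sub>0" "U\<^sub>0 \<noteq> {}"
    and "finite J\<^sub>0'" "U\<^sub>0' = sublevel_set J\<^sub>0' \<tau>\<^sub>0'" "U\<^sub>0' \<noteq> {}"
    and "\<And>i. i \<in> I \<Longrightarrow> finite (J i)"
    and "\<And>i. i \<in> I \<Longrightarrow> U i = sublevel_set (J i) (\<tau> i)"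
    and "\<And>i. i \<in> I \<Longrightarrow> U i \<noteq> {}"
    and a_\<tau>\<^sub>0: "\<And>j. j \<in> J\<^sub>0 \<Longrightarrow> convex_on UNIV (\<tau>\<^sub>0 j)"
    and a_\<tau>\<^sub>0': "\<And>j. j \<in> J\<^sub>0' \<Longrightarrow> convex_on UNIV (\<tau>\<^sub>0' j)"
    and a_\<tau>: "\<And>i j. i \<in> I \<Longrightarrow> j \<in> J i \<Longrightarrow> convex_on UNIV (\<tau> i j)"
    and a_U\<^sub>0: "convex U\<^sub>0" "compact U\<^sub>0"
    and a_U\<^sub>0': "convex U\<^sub>0'" "compact U\<^sub>0'"
    and a_U: "\<And>i. i \<in> I \<Longrightarrow> convex (U i)" "\<And>i. i \<in> I \<Longrightarrow> compact (U i)"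
    and b_f: "\<And>a. a \<in> U\<^sub>0 \<Longrightarrow> convex_on UNIV (\<lambda>x. f a x)"
    and b_h: "\<And>i a. i \<in> I \<Longrightarrow> a \<in> U i \<Longrightarrow> convex_on UNIV (\<lambda>x. h i a x)"
    and c: "\<And>a. a \<in> U\<^sub>0' \<Longrightarrow> concave_on UNIV (\<lambda>x. g a x)"
    and d_f: "\<And>x. robust_feasible I U h x \<Longrightarrow> concave_on UNIV (\<lambda>a. f a x)"
    and d_h: "\<And>i x. i \<in> I \<Longrightarrow> robust_feasible I U h x \<Longrightarrow> concave_on UNIV (\<lambda>a. h i a x)"
    and e: "\<And>x. robust_feasible I U h x \<Longrightarrow> convex_on UNIV (\<lambda>a. g a x)"
    and f: "\<And>a x. a \<in> U\<^sub>0' \<Longrightarrow> robust_feasible I U h x \<Longrightarrow> g a x > 0"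
    and g: "\<And>x. robust_feasible I U h x \<Longrightarrow> \<exists>a\<in>U\<^sub>0. f a x \<ge> 0"
  shows "(\<forall>\<alpha> x. (\<alpha>, x) \<in> RS1 U\<^sub>0 U\<^sub>0' I U f g h \<longleftrightarrow>
            (\<exists>t y. t > 0 \<and> x = y /\<^sub>R t \<and> (\<alpha>, t, y) \<in> RSchaibleS1 U\<^sub>0 U\<^sub>0' I U f g h)) \<and>
         (\<forall>\<alpha> x. is_arg_min fst (\<lambda>p. p \<in> RS1 U\<^sub>0 U\<^sub>0' I U f g h) (\<alpha>, x) \<longleftrightarrow>
            (\<exists>t y. t > 0 \<and> x = y /\<^sub>R t \<and>
              is_arg_min fst (\<lambda>p. p \<in> RSchaibleS1 U\<^sub>0 U\<^sub>0' I U f g h) (\<alpha>, t, y)))"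
proof -
  let ?R = "RS1 U\<^sub>0 U\<^sub>0' I U f g h" and ?S = "RSchaibleS1 U\<^sub>0 U\<^sub>0' I U f g h"
  have bound_iff: "(\<forall>a\<in>U\<^sub>0. \<forall>a'\<in>U\<^sub>0'. f a x / g a' x - \<alpha> \<le> 0) \<longleftrightarrow>
      (\<exists>t>0. (\<forall>a\<in>U\<^sub>0. t * f a x - \<alpha> \<le> 0) \<and> (\<forall>a'\<in>U\<^sub>0'. t * g a' x \<ge> 1))"
    if "robust_feasible I U h x" "\<alpha> \<ge> 0" for \<alpha> x
  proof (rule robust_quotient_bound_iff_scaled)
    show "continuous_on U\<^sub>0' (\<lambda>a. g a x)"
      using convex_on_continuous[OF open_UNIV e[OF that(1)]] continuous_on_subset by blast
  qed (use that f a_U\<^sub>0' \<open>U\<^sub>0' \<noteq> {}\<close> in auto)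
  have h_iff: "(\<forall>i\<in>I. \<forall>a\<in>U i. t * h i a x \<le> 0) \<longleftrightarrow> robust_feasible I U h x" if "t > 0" for t x
    using that by (simp add: robust_feasible_def mult_le_0_iff not_le)
  have S_iff: "(\<alpha>, t, t *\<^sub>R x) \<in> ?S \<longleftrightarrow> \<alpha> \<ge> 0 \<and> robust_feasible I U h x \<and>
      (\<forall>a\<in>U\<^sub>0. t * f a x - \<alpha> \<le> 0) \<and> (\<forall>a'\<in>U\<^sub>0'. t * g a' x \<ge> 1)"
    if "t > 0" for \<alpha> t x
    using that h_iff[OF that, of x] by (auto simp: RSchaibleS1_def)
  have R_iff: "(\<alpha>, x) \<in> ?R \<longleftrightarrow> (\<exists>t>0. (\<alpha>, t, t *\<^sub>R x) \<in> ?S)" for \<alpha> x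
  proof -
    have "(\<alpha>, x) \<in> ?R \<longleftrightarrow> \<alpha> \<ge> 0 \<and> robust_feasible I U h x \<and>
        (\<forall>a\<in>U\<^sub>0. \<forall>a'\<in>U\<^sub>0'. f a x / g a' x - \<alpha> \<le> 0)"
      by (auto simp: RS1_def robust_feasible_def)
    then show ?thesis
      using bound_iff[of x \<alpha>] S_iff by blast
  qed
  have S_pos: "(\<alpha>, t, y) \<in> ?S \<Longrightarrow> t > 0" for \<alpha> t y
    by (simp add: RSchaibleS1_def)
  have feasible: "(\<alpha>, x) \<in> ?R \<longleftrightarrow> (\<exists>t y. t > 0 \<and> x = y /\<^sub>R t \<and> (\<alpha>, t, y) \<in> ?S)"
    (is "_ \<longleftrightarrow> ?rhs") for \<alpha> x
  proof -
    have "?rhs \<longleftrightarrow> (\<exists>t>0. (\<alpha>, t, t *\<^sub>R x) \<in> ?S)"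
    proof
      assume ?rhs
      then obtain t y where "t > 0" "x = y /\<^sub>R t" "(\<alpha>, t, y) \<in> ?S"
        by (elim exE conjE)
      then show "\<exists>t>0. (\<alpha>, t, t *\<^sub>R x) \<in> ?S"
        by (intro exI[of _ t]) simp
    next
      assume "\<exists>t>0. (\<alpha>, t, t *\<^sub>R x) \<in> ?S"
      then obtain t where "t > 0" "(\<alpha>, t, t *\<^sub>R x) \<in> ?S"
        by (elim exE conjE)
      then show ?rhs
        by (intro exI[of _ t] exI[of _ "t *\<^sub>R x"]) simp
    qed
    with R_iff show ?thesis
      by simp
  qed
  have optimal: "is_arg_min fst (\<lambda>p. p \<in> ?R) (\<alpha>, x) \<longleftrightarrow> is_arg_min fst (\<lambda>p. p \<in> ?S) (\<alpha>, t, y)"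
    if "(\<alpha>, x) \<in> ?R" "(\<alpha>, t, y) \<in> ?S" for \<alpha> x t y
  proof (rule is_arg_min_transfer)
    show "\<exists>q. q \<in> ?S \<and> fst q = fst p" if "p \<in> ?R" for p
    proof -
      obtain \<beta> z where p: "p = (\<beta>, z)"
        by (cases p)
      with that R_iff obtain s where "(\<beta>, s, s *\<^sub>R z) \<in> ?S"
        by auto
      then show ?thesis
        using p by force
    qed
    show "\<exists>p. p \<in> ?R \<and> fst p = fst q" if "q \<in> ?S" for q
    proof -
      obtain \<beta> s z where q: "q = (\<beta>, s, z)"
        by (cases q)
      with that have S: "(\<beta>, s, z) \<in> ?S"
        by simp
      have "(\<beta>, z /\<^sub>R s) \<in> ?R"
        by (rule iffD2[OF feasible], intro exI conjI) (rule S_pos[OF S], rule refl, rule S)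
      then show ?thesis
        using q by force
    qed
  qed (use that in auto)
  have minimizers: "is_arg_min fst (\<lambda>p. p \<in> ?R) (\<alpha>, x) \<longleftrightarrow>
      (\<exists>t y. t > 0 \<and> x = y /\<^sub>R t \<and> is_arg_min fst (\<lambda>p. p \<in> ?S) (\<alpha>, t, y))"
    (is "?lhs \<longleftrightarrow> ?rhs") for \<alpha> x
  proof
    assume L: ?lhs
    then have R: "(\<alpha>, x) \<in> ?R"
      by (simp add: is_arg_min_def)
    obtain t y where ty: "t > 0" "x = y /\<^sub>R t" "(\<alpha>, t, y) \<in> ?S"
      using iffD1[OF feasible R] by (elim exE conjE)
    with L optimal[OF R ty(3)] show ?rhs
      by (intro exI[of _ t] exI[of _ y]) simp
  next
    assume ?rhs
    then obtain t y where ty: "t > 0" "x = y /\<^sub>R t" and M: "is_arg_min fst (\<lambda>p. p \<in> ?S) (\<alpha>, t, y)"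
      by (elim exE conjE)
    then have S: "(\<alpha>, t, y) \<in> ?S"
      by (simp add: is_arg_min_def)
    have "(\<alpha>, x) \<in> ?R"
      by (rule iffD2[OF feasible], intro exI conjI) (fact ty(1), fact ty(2), fact S)
    with M optimal[OF this S] show ?lhs
      by simp
  qed
  show ?thesis
    by (intro conjI allI) (rule feasible, rule minimizers)
qed

end
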